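(* The strategies $(A1)$, $(A2)$, $(A3)$, $(A1')$, $(A2')$, $(A3')$ for Alice are not optimal for all complete multipartite graphs: there exists a complete multipartite graph $G$ such that none of these six strategies (whenever applicable to $G$) is a winning strategy for Alice in the graph coloring game on $G$ with exactly $\chi_g(G)$ colors.
   Context: Graph coloring game: given a graph $G$ and a finite set $C$ of colors, Alice and Bob alternately (Alice first) pick an uncolored vertex and give it a legal color, i.e. a color from $C$ not used on any neighbor. The game ends when all vertices are colored (Alice wins) or when no uncolored vertex has a legal color (Bob wins). The game chromatic number $\chi_g(G)$ is the minimum $|C|$ for which Alice has a winning strategy. A strategy for Alice (possibly leaving some choices free) is winning if in every play in which Alice follows it, the whole graph gets colored. $K_{r_1,\ldots,r_k}$ denotes the complete $k$-partite graph with parts (independent sets) $V_1,\ldots,V_k$, $|V_i|=r_i\ge1$, $r_1\ge\cdots\ge r_k$, every two vertices in different parts adjacent; the paper assumes that if $k\ge2$ then $r_1\ge 2$; $n=\sum_i r_i$. A part is uncolored / partially colored / fully colored if none / some but not all / all of its vertices are colored; a singleton is a part of size $1$. A "new color" is a color of $C$ not yet used on any vertex. Strategy $(A1)$: if there is an uncolored part, pick any vertex of any uncolored part and assign a new color; otherwise pick any uncolored vertex in a partially colored part $V_i$ and give it a color already used in $V_i$. Strategy $(A2)$ (for a fixed $j$ with $r_j=3$): (1) first move: color a vertex of $V_j$ with a new color; (2) otherwise, if Bob's last move was in $V_j$, color another uncolored vertex of $V_j$ with the color Bob just used; (3) otherwise, if there is an uncolored part, color any vertex of one with a new color; (4) otherwise,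 color any uncolored vertex of a partially colored part $V_i$ with a color already used in $V_i$. Strategy $(A3)$ (for $n$ odd): (1) first move: color a vertex of a part of smallest odd size with a new color; (2) otherwise, if Bob's last move was in a partially colored part $V_i$, color another uncolored vertex of $V_i$ with the color Bob just used; (3) otherwise, if there is a partially colored part $V_i$, color any uncolored vertex of it with a color already used in $V_i$; (4) otherwise, color any vertex of an uncolored part of smallest odd size with a new color. Strategies $(A1')$, $(A2')$, $(A3')$ are obtained from $(A1)$, $(A2)$, $(A3)$ respectively by adding the rule "if there is an uncolored singleton, color it with a new color", with the highest priority in $(A1')$ and $(A3')$, and in $(A2')$ with priority just below rules (1) and (2) of $(A2)$ (those forcing Alice to play in $V_j$). *)

theory Defs
  imports Main
begin

section \<open>The graph coloring game\<close>

text \<open>A play is the list of moves (vertex, color) made so far, most recent move first, so that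
  \<^term>\<open>map_of h\<close> is the current partial coloring and Alice is to move iff the length is even.\<close>

type_synonym ('v, 'c) play = "('v \<times> 'c) list"

definition legal_moves ::
  "'v set \<Rightarrow> ('v \<Rightarrow> 'v \<Rightarrow> bool) \<Rightarrow> 'c set \<Rightarrow> ('v, 'c) play \<Rightarrow> ('v \<times> 'c) set" where
  "legal_moves V adj C h =
     {(v, c). v \<in> V \<and> map_of h v = None \<and> c \<in> C \<and> (\<forall>u\<in>V. adj v u \<longrightarrow> map_of h u \<noteq> Some c)}"

text \<open>A strategy for Alice assigns to each play the set of moves she may choose from.
  The following are the (initial segments of) plays in which Alice follows \<open>S\<close>
  and Bob moves arbitrarily.\<close>

inductive_set plays ::
  "'v set \<Rightarrow> ('v \<Rightarrow> 'v \<Rightarrow> bool) \<Rightarrow> 'c set \<Rightarrow> (('v, 'c) play \<Rightarrow> ('v \<times> 'c) set) \<Rightarrow> ('v, 'c) play set"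
  for V :: "'v set" and adj :: "'v \<Rightarrow> 'v \<Rightarrow> bool" and C :: "'c set"
    and S :: "('v, 'c) play \<Rightarrow> ('v \<times> 'c) set" where
  start: "[] \<in> plays V adj C S"
| Alice: "h \<in> plays V adj C S \<Longrightarrow> even (length h) \<Longrightarrow> m \<in> S h \<Longrightarrow> m \<in> legal_moves V adj C h
    \<Longrightarrow> m # h \<in> plays V adj C S"
| Bob: "h \<in> plays V adj C S \<Longrightarrow> odd (length h) \<Longrightarrow> m \<in> legal_moves V adj C h
    \<Longrightarrow> m # h \<in> plays V adj C S"

text \<open>In a finite graph every play extends to a maximal one. A play that cannot be continued
  because \<open>S\<close> offers Alice no legal move counts as a failure of \<open>S\<close>.\<close>

definition winning_strategy ::
  "'v set \<Rightarrow> ('v \<Rightarrow> 'v \<Rightarrow> bool) \<Rightarrow> 'c set \<Rightarrow> (('v, 'c) play \<Rightarrow> ('v \<times> 'c) set) \<Rightarrow> bool" where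
  "winning_strategy V adj C S \<longleftrightarrow>
     (\<forall>h \<in> plays V adj C S. (\<forall>m. m # h \<notin> plays V adj C S) \<longrightarrow> (\<forall>v\<in>V. map_of h v \<noteq> None))"

definition game_chromatic_number :: "'v set \<Rightarrow> ('v \<Rightarrow> 'v \<Rightarrow> bool) \<Rightarrow> nat" where
  "game_chromatic_number V adj = (LEAST k. \<exists>S. winning_strategy V adj {..<k} S)"

section \<open>Complete multipartite graphs\<close>

text \<open>The graph is given by its list of part sizes; parts are indexed from 0 and the vertices of
  part \<open>i\<close> are the pairs with first component \<open>i\<close>.\<close>

type_synonym vertex = "nat \<times> nat"

definition part_sizes :: "nat list \<Rightarrow> bool" where
  "part_sizes rs \<longleftrightarrow> rs \<noteq> [] \<and> (\<forall>r \<in> set rs. 1 \<le> r) \<and> sorted_wrt (\<ge>) rs \<and>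
     (2 \<le> length rs \<longrightarrow> 2 \<le> rs ! 0)"

definition part :: "nat list \<Rightarrow> nat \<Rightarrow> vertex set" where
  "part rs i = {i} \<times> {..<rs ! i}"

definition vertices :: "nat list \<Rightarrow> vertex set" where
  "vertices rs = (\<Union>i<length rs. part rs i)"

definition adjacent :: "vertex \<Rightarrow> vertex \<Rightarrow> bool" where
  "adjacent u v \<longleftrightarrow> fst u \<noteq> fst v"

definition uncolored_part :: "nat list \<Rightarrow> (vertex, 'c) play \<Rightarrow> nat \<Rightarrow> bool" where
  "uncolored_part rs h i \<longleftrightarrow> i < length rs \<and> (\<forall>v \<in> part rs i. map_of h v = None)"

definition partially_colored_part :: "nat list \<Rightarrow> (vertex, 'c) play \<Rightarrow> nat \<Rightarrow> bool" where
  "partially_colored_part rs h i \<longleftrightarrow> i < length rs \<and>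
     (\<exists>v \<in> part rs i. map_of h v \<noteq> None) \<and> (\<exists>v \<in> part rs i. map_of h v = None)"

definition uncolored_singleton :: "nat list \<Rightarrow> (vertex, 'c) play \<Rightarrow> nat \<Rightarrow> bool" where
  "uncolored_singleton rs h i \<longleftrightarrow> uncolored_part rs h i \<and> rs ! i = 1"

definition smallest_odd_uncolored_part :: "nat list \<Rightarrow> (vertex, 'c) play \<Rightarrow> nat \<Rightarrow> bool" where
  "smallest_odd_uncolored_part rs h i \<longleftrightarrow> uncolored_part rs h i \<and> odd (rs ! i) \<and>
     (\<forall>i'. uncolored_part rs h i' \<and> odd (rs ! i') \<longrightarrow> rs ! i \<le> rs ! i')"

section \<open>Strategies for Alice\<close>

definition new_color_moves ::
  "nat list \<Rightarrow> 'c set \<Rightarrow> (vertex, 'c) play \<Rightarrow> (nat \<Rightarrow> bool) \<Rightarrow> (vertex \<times> 'c) set" where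
  "new_color_moves rs C h P =
     {(v, c). (\<exists>i. P i \<and> v \<in> part rs i) \<and> map_of h v = None \<and> c \<in> C \<and> c \<notin> ran (map_of h)}"

definition reuse_color_moves :: "nat list \<Rightarrow> (vertex, 'c) play \<Rightarrow> (vertex \<times> 'c) set" where
  "reuse_color_moves rs h =
     {(v, c). \<exists>i. partially_colored_part rs h i \<and> v \<in> part rs i \<and> map_of h v = None \<and>
        (\<exists>u \<in> part rs i. map_of h u = Some c)}"

definition same_color_moves ::
  "nat list \<Rightarrow> (vertex, 'c) play \<Rightarrow> nat \<Rightarrow> 'c \<Rightarrow> (vertex \<times> 'c) set" where
  "same_color_moves rs h i b = {(v, c). v \<in> part rs i \<and> map_of h v = None \<and> c = b}"

definition strategy_A1 :: "nat list \<Rightarrow> 'c set \<Rightarrow> (vertex, 'c) play \<Rightarrow> (vertex \<times> 'c) set" where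
  "strategy_A1 rs C h =
     (if \<exists>i. uncolored_part rs h i then new_color_moves rs C h (uncolored_part rs h)
      else reuse_color_moves rs h)"

definition strategy_A1' :: "nat list \<Rightarrow> 'c set \<Rightarrow> (vertex, 'c) play \<Rightarrow> (vertex \<times> 'c) set" where
  "strategy_A1' rs C h =
     (if \<exists>i. uncolored_singleton rs h i then new_color_moves rs C h (uncolored_singleton rs h)
      else strategy_A1 rs C h)"

text \<open>Below, \<open>w\<close> and \<open>b\<close> are the vertex and the color of Bob's last move. Since \<open>w\<close> is colored,
  part \<open>fst w\<close> is partially colored iff it still has an uncolored vertex.\<close>

definition strategy_A2 ::
  "nat list \<Rightarrow> 'c set \<Rightarrow> nat \<Rightarrow> (vertex, 'c) play \<Rightarrow> (vertex \<times> 'c) set" where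
  "strategy_A2 rs C j h =
     (case h of
        [] \<Rightarrow> new_color_moves rs C h (\<lambda>i. i = j)
      | (w, b) # _ \<Rightarrow>
          if fst w = j \<and> partially_colored_part rs h j then same_color_moves rs h j b
          else if \<exists>i. uncolored_part rs h i then new_color_moves rs C h (uncolored_part rs h)
          else reuse_color_moves rs h)"

definition strategy_A2' ::
  "nat list \<Rightarrow> 'c set \<Rightarrow> nat \<Rightarrow> (vertex, 'c) play \<Rightarrow> (vertex \<times> 'c) set" where
  "strategy_A2' rs C j h =
     (case h of
        [] \<Rightarrow> new_color_moves rs C h (\<lambda>i. i = j)
      | (w, b) # _ \<Rightarrow>
          if fst w = j \<and> partially_colored_part rs h j then same_color_moves rs h j b
          else if \<exists>i. uncolored_singleton rs h i
            then new_color_moves rs C h (uncolored_singleton rs h)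
          else if \<exists>i. uncolored_part rs h i then new_color_moves rs C h (uncolored_part rs h)
          else reuse_color_moves rs h)"

definition strategy_A3 :: "nat list \<Rightarrow> 'c set \<Rightarrow> (vertex, 'c) play \<Rightarrow> (vertex \<times> 'c) set" where
  "strategy_A3 rs C h =
     (case h of
        [] \<Rightarrow> new_color_moves rs C h (smallest_odd_uncolored_part rs h)
      | (w, b) # _ \<Rightarrow>
          if partially_colored_part rs h (fst w) then same_color_moves rs h (fst w) b
          else if \<exists>i. partially_colored_part rs h i then reuse_color_moves rs h
          else new_color_moves rs C h (smallest_odd_uncolored_part rs h))"

definition strategy_A3' :: "nat list \<Rightarrow> 'c set \<Rightarrow> (vertex, 'c) play \<Rightarrow> (vertex \<times> 'c) set" where
  "strategy_A3' rs C h =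
     (if \<exists>i. uncolored_singleton rs h i then new_color_moves rs C h (uncolored_singleton rs h)
      else strategy_A3 rs C h)"

end

theory Submission
  imports Defs
begin

text \<open>The witness is \<open>K\<^bsub>2,1,1,1,1\<^esub>\<close>, whose game chromatic number is 5, the number of parts; it has
  no part of size 3 and an even number of vertices, so that only (A1) and (A1') apply to it.
  With 5 colors Alice must prevent Bob from using two colors on the part of size 2 while a singleton
  is uncolored. She achieves this by completing that part as soon as Bob has started it and by
  coloring singletons otherwise. Strategies (A1) and (A1') instead allow her to color a second
  singleton after Bob has started the part, whereupon Bob wastes a color there.\<close>

section \<open>General properties of plays\<close>

lemma legal_moves_if_Cons_in_plays:
  assumes "m # h \<in> plays V adj C S"
  shows "m \<in> legal_moves V adj C h"
  using assms by (auto elim: plays.cases)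

lemma plays_distinct_vertices:
  assumes "h \<in> plays V adj C S"
  shows "distinct (map fst h) \<and> fst ` set h \<subseteq> V"
  using assms
  by induction (auto simp: legal_moves_def map_of_eq_None_iff rev_image_eqI)

lemma plays_colors:
  assumes "h \<in> plays V adj C S"
  shows "ran (map_of h) \<subseteq> C"
  using assms
  by induction (auto simp: legal_moves_def ran_def split: if_splits)

text \<open>Induction step of \<open>plays_proper\<close>, common to both players. Legality keeps
  the new color off neighbors in \<open>V\<close> only; since \<open>h\<close> colors nothing
  outside \<open>V\<close>, this covers all neighbors, and symmetry of \<open>adj\<close> handles
  either end of the edge.\<close>

lemma proper_Cons:
  assumes "m \<in> legal_moves V adj C h" and "symp adj" and "irreflp adj" and "fst ` set h \<subseteq> V"
    and proper: "\<And>u v c. adj u v \<Longrightarrow> map_of h u = Some c \<Longrightarrow> map_of h v \<noteq> Some c"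
    and "adj u v" and "map_of (m # h) u = Some c"
  shows "map_of (m # h) v \<noteq> Some c"
proof
  assume v: "map_of (m # h) v = Some c"
  obtain w d where m: "m = (w, d)"
    by (cases m)
  have fresh: "map_of h x \<noteq> Some d" if "adj w x" for x
  proof
    assume "map_of h x = Some d"
    moreover from this have "x \<in> V"
      using \<open>fst ` set h \<subseteq> V\<close> by (force dest: map_of_SomeD)
    ultimately show False
      using assms(1) that by (auto simp: m legal_moves_def)
  qed
  have "adj v u" "u \<noteq> v"
    using assms(2,3) \<open>adj u v\<close> by (auto dest: sympD irreflpD)
  then show False
    using fresh[of u] fresh[of v] proper[of u v c] v assms(6,7) by (auto simp: m split: if_splits)
qed

lemma plays_proper:
  assumes "h \<in> plays V adj C S" and "symp adj" and "irreflp adj"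
    and "adj u v" and "map_of h u = Some c"
  shows "map_of h v \<noteq> Some c"
  using assms(1,4,5)
proof (induction arbitrary: u v c)
  case start
  then show ?case by simp
next
  case (Alice h m)
  have "fst ` set h \<subseteq> V"
    using plays_distinct_vertices[OF Alice.hyps(1)] ..
  then show ?case
    by (rule proper_Cons[OF Alice.hyps(4) assms(2,3) _ _ Alice.prems]) (rule Alice.IH)
next
  case (Bob h m)
  have "fst ` set h \<subseteq> V"
    using plays_distinct_vertices[OF Bob.hyps(1)] ..
  then show ?case
    by (rule proper_Cons[OF Bob.hyps(3) assms(2,3) _ _ Bob.prems]) (rule Bob.IH)
qed

lemma plays_length_le:
  assumes "h \<in> plays V adj C S" and "finite V"
  shows "length h \<le> card V"
proof -
  have "length h = card (fst ` set h)"
    using plays_distinct_vertices[OF assms(1)] distinct_card[of "map fst h"] by simp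
  then show ?thesis
    using plays_distinct_vertices[OF assms(1)] assms(2) by (simp add: card_mono)
qed

section \<open>Complete plays and the clique bound\<close>

text \<open>Play lengths are bounded by \<open>card V\<close>, so a longest play exists; it cannot
  be continued, hence winning forces it to be complete.\<close>

lemma winning_strategy_complete_play:
  assumes "winning_strategy V adj C S" and "finite V"
  obtains h where "h \<in> plays V adj C S" and "\<forall>v\<in>V. map_of h v \<noteq> None"
proof -
  have "length g < Suc (card V)" if "g \<in> plays V adj C S" for g
    using plays_length_le[OF that assms(2)] by simp
  then have "\<exists>h. h \<in> plays V adj C S \<and> (\<forall>g. g \<in> plays V adj C S \<longrightarrow> length g \<le> length h)"
    using plays.start ex_has_greatest_nat[of "\<lambda>g. g \<in> plays V adj C S" "[]" length "Suc (card V)"]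
    by blast
  then obtain h where h: "h \<in> plays V adj C S"
    and max: "\<And>g. g \<in> plays V adj C S \<Longrightarrow> length g \<le> length h"
    by blast
  have "m # h \<notin> plays V adj C S" for m
    using max[of "m # h"] by auto
  then show ?thesis
    using assms(1) h that by (auto simp: winning_strategy_def)
qed

text \<open>A complete play is a proper coloring, hence injective on a clique.\<close>

lemma winning_strategy_clique_le:
  assumes "winning_strategy V adj {..<k} S" and "finite V" and "symp adj" and "irreflp adj"
    and "K \<subseteq> V" and clique: "\<And>u v. u \<in> K \<Longrightarrow> v \<in> K \<Longrightarrow> u \<noteq> v \<Longrightarrow> adj u v"
  shows "card K \<le> k"
proof -
  obtain h where h: "h \<in> plays V adj {..<k} S" and full: "\<forall>v\<in>V. map_of h v \<noteq> None"
    using winning_strategy_complete_play[OF assms(1,2)] .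
  have "inj_on (\<lambda>v. the (map_of h v)) K"
  proof (rule inj_onI, rule ccontr)
    fix u v
    assume uv: "u \<in> K" "v \<in> K" "the (map_of h u) = the (map_of h v)" "u \<noteq> v"
    then obtain c where "map_of h u = Some c" "map_of h v = Some c"
      using full \<open>K \<subseteq> V\<close> by fastforce
    then show False
      using plays_proper[OF h assms(3,4) clique] uv by blast
  qed
  moreover have "(\<lambda>v. the (map_of h v)) ` K \<subseteq> {..<k}"
    using plays_colors[OF h] full \<open>K \<subseteq> V\<close> by (fastforce intro: ranI)
  ultimately show ?thesis
    using card_inj_on_le[of _ K "{..<k}"] by simp
qed

section \<open>Availability of new colors\<close>

lemma new_color_legal:
  assumes "v \<in> V" and "map_of h v = None" and "c \<in> C" and "c \<notin> ran (map_of h)"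
  shows "(v, c) \<in> legal_moves V adj C h"
  using assms by (auto simp: legal_moves_def intro: ranI)

text \<open>Pigeonhole: \<open>D\<close> holds a representative vertex for every used color. An
  uncolored vertex of \<open>D\<close> contributes only the value \<open>the None\<close>, which
  does not affect the count.\<close>

lemma new_color_exists:
  assumes "finite D" and "card D < k" and "ran (map_of h) \<subseteq> (\<lambda>v. the (map_of h v)) ` D"
  shows "\<exists>c<k. c \<notin> ran (map_of h)"
proof (rule ccontr)
  assume "\<not> ?thesis"
  then have "{..<k} \<subseteq> (\<lambda>v. the (map_of h v)) ` D"
    using assms(3) by blast
  then have "k \<le> card D"
    using surj_card_le[OF assms(1)] by fastforce
  then show False
    using assms(2) by simp
qed

lemma symp_adjacent: "symp adjacent"
  by (auto simp: adjacent_def intro: sympI)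

lemma irreflp_adjacent: "irreflp adjacent"
  by (auto simp: adjacent_def intro: irreflpI)

section \<open>The witness graph and its parts\<close>

definition witness :: "nat list" where
  "witness = [2, 1, 1, 1, 1]"

lemma part_witness:
  "part witness 0 = {(0, 0), (0, 1)}" "part witness (Suc 0) = {(1, 0)}" "part witness 2 = {(2, 0)}"
  "part witness 3 = {(3, 0)}" "part witness 4 = {(4, 0)}"
  by (auto simp: witness_def part_def eval_nat_numeral less_Suc_eq)

lemma vertices_witness: "vertices witness = {(0, 0), (0, 1), (1, 0), (2, 0), (3, 0), (4, 0)}"
proof -
  have "{..<length witness} = {0, Suc 0, 2, 3, 4}"
    by (auto simp: witness_def)
  then show ?thesis
    unfolding vertices_def by (simp only: image_insert image_empty part_witness) auto
qed

section \<open>A winning strategy with five colors\<close>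

text \<open>The last branch matters only when the pair, part 0, is the sole part left; on a complete
  coloring it offers no move.\<close>

definition completing_strategy :: "nat set \<Rightarrow> (vertex, nat) play \<Rightarrow> (vertex \<times> nat) set" where
  "completing_strategy C h =
     (if partially_colored_part witness h 0 then reuse_color_moves witness h
      else if \<exists>i. uncolored_singleton witness h i
        then new_color_moves witness C h (uncolored_singleton witness h)
      else new_color_moves witness C h (uncolored_part witness h))"

lemma witness_index_cases:
  "i < length witness \<longleftrightarrow> i = 0 \<or> i = Suc 0 \<or> i = 2 \<or> i = 3 \<or> i = 4"
  by (auto simp: witness_def)

lemma partially_colored_part_witness:
  "partially_colored_part witness h i \<longleftrightarrow>
     i = 0 \<and> (map_of h (0, 0) = None) \<noteq> (map_of h (0, 1) = None)"
  unfolding partially_colored_part_def witness_index_cases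
  by (auto simp: part_witness)

lemma uncolored_part_witness:
  "uncolored_part witness h i \<longleftrightarrow>
     i = 0 \<and> map_of h (0, 0) = None \<and> map_of h (0, 1) = None \<or>
     i \<in> {1, 2, 3, 4} \<and> map_of h (i, 0) = None"
  unfolding uncolored_part_def witness_index_cases
  by (auto simp: part_witness)

lemma uncolored_singleton_witness:
  "uncolored_singleton witness h i \<longleftrightarrow> i \<in> {1, 2, 3, 4} \<and> map_of h (i, 0) = None"
  unfolding uncolored_singleton_def uncolored_part_witness by (auto simp: witness_def)

text \<open>From this point on Bob cannot win with five colors: the singletons occupy four, and the
  fifth remains for the pair.\<close>

definition singletons_colored :: "(vertex, nat) play \<Rightarrow> bool" where
  "singletons_colored h \<longleftrightarrow> (\<forall>i\<in>{1, 2, 3, 4}. map_of h (i, 0) \<noteq> None)"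

lemma singletons_colored_Cons: "singletons_colored h \<Longrightarrow> singletons_colored (m # h)"
  by (cases m) (auto simp: singletons_colored_def)

text \<open>The equality covers both an untouched pair and a pair in one color. The third
  alternative is the position in which Bob has just opened the pair; Alice's reply restores the
  equality.\<close>

lemma completing_strategy_invariant:
  assumes "h \<in> plays (vertices witness) adjacent C (completing_strategy C)"
  shows "singletons_colored h \<or> map_of h (0, 0) = map_of h (0, 1) \<or>
    even (length h) \<and> (map_of h (0, 0) = None \<or> map_of h (0, 1) = None)"
  using assms
proof induction
  case start
  then show ?case by simp
next
  case (Alice h m)
  obtain v c where m: "m = (v, c)"
    by (cases m)
  show ?case
  proof (cases "singletons_colored h")
    case True
    then show ?thesis by (simp add: singletons_colored_Cons)
  next
    case False
    then have single: "\<exists>i. uncolored_singleton witness h i"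
      by (auto simp: singletons_colored_def uncolored_singleton_witness)
    show ?thesis
    proof (cases "partially_colored_part witness h 0")
      case True
      then have "(v, c) \<in> reuse_color_moves witness h"
        using Alice.hyps(3) by (simp add: m completing_strategy_def)
      then have "map_of (m # h) (0, 0) = map_of (m # h) (0, 1)"
        by (auto simp: m reuse_color_moves_def partially_colored_part_witness part_witness)
      then show ?thesis by simp
    next
      case False
      then have "(v, c) \<in> new_color_moves witness C h (uncolored_singleton witness h)"
        using Alice.hyps(3) single by (simp add: m completing_strategy_def)
      then have "v \<noteq> (0, 0)" "v \<noteq> (0, 1)"
        by (auto simp: new_color_moves_def uncolored_singleton_witness part_def)
      \<comment> \<open>If the third alternative of the induction hypothesis holds, a pair that is
        not partially colored is untouched.\<close>
      moreover have "map_of h (0, 0) = map_of h (0, 1)"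
        using Alice.IH False \<open>\<not> singletons_colored h\<close> by (auto simp: partially_colored_part_witness)
      ultimately show ?thesis by (simp add: m)
    qed
  qed
next
  case (Bob h m)
  \<comment> \<open>The length is odd before Bob's move, so while a singleton is uncolored the two
    entries agree; a move into the pair then starts from an untouched pair and colors only one
    vertex.\<close>
  then show ?case
    by (cases m) (auto simp: legal_moves_def singletons_colored_Cons)
qed

lemma ran_map_of_subset_image:
  assumes "h \<in> plays V adj C S"
    and "\<And>v. v \<in> V \<Longrightarrow> map_of h v \<noteq> None \<Longrightarrow> \<exists>u\<in>D. map_of h u = map_of h v"
  shows "ran (map_of h) \<subseteq> (\<lambda>v. the (map_of h v)) ` D"
proof
  fix c
  assume "c \<in> ran (map_of h)"
  then obtain v where v: "map_of h v = Some c"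
    by (auto simp: ran_def)
  then have "v \<in> V"
    using plays_distinct_vertices[OF assms(1)] by (force dest: map_of_SomeD)
  then obtain u where "u \<in> D" "map_of h u = Some c"
    using assms(2) v by force
  then show "c \<in> (\<lambda>v. the (map_of h v)) ` D"
    by force
qed

text \<open>The parity of \<open>h\<close> is left open: the legal move found serves Alice at her
  turns and shows that Bob is not stuck at his.\<close>

lemma completing_strategy_moves:
  assumes h: "h \<in> plays (vertices witness) adjacent {..<5} (completing_strategy {..<5})"
    and v: "v \<in> vertices witness" "map_of h v = None"
  shows "completing_strategy {..<5} h \<inter> legal_moves (vertices witness) adjacent {..<5} h \<noteq> {}"
    (is "?S \<inter> ?L \<noteq> {}")
proof (cases "partially_colored_part witness h 0")
  case True
  then obtain u w c where uw: "map_of h u = None" "map_of h w = Some c"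
    and uw': "u \<in> {(0, 0), (0, 1)}" "w \<in> {(0, 0), (0, 1)}"
    by (auto simp: partially_colored_part_witness)
  have "(u, c) \<in> reuse_color_moves witness h"
    using True uw uw' unfolding reuse_color_moves_def by (auto simp: part_witness)
  moreover have "c \<in> {..<5}"
    using plays_colors[OF h] uw(2) by (auto intro: ranI)
  \<comment> \<open>\<open>w\<close> lies in the same part as \<open>u\<close>, so by properness no
    neighbor of \<open>u\<close> has its color \<open>c\<close>.\<close>
  then have "(u, c) \<in> ?L"
    using uw uw' plays_proper[OF h symp_adjacent irreflp_adjacent _ uw(2)]
    by (auto simp: legal_moves_def vertices_witness adjacent_def)
  ultimately show ?thesis
    using True by (auto simp: completing_strategy_def)
next
  case False
  have mono: "singletons_colored h \<or> map_of h (0, 0) = map_of h (0, 1)"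
    using completing_strategy_invariant[OF h] False by (auto simp: partially_colored_part_witness)
  \<comment> \<open>This unifies the two branches that use a new color, with \<open>i\<close> a part
    to open. The last clause makes \<open>i\<close> the pair once all singletons are colored, so
    that in either case the pair carries at most one color.\<close>
  obtain P i where P: "?S = new_color_moves witness {..<5} h P" "P i"
    "uncolored_part witness h i" "\<not> singletons_colored h \<or> i = 0"
  proof (cases "singletons_colored h")
    case True
    then have "\<not> (\<exists>i. uncolored_singleton witness h i)"
      by (auto simp: singletons_colored_def uncolored_singleton_witness)
    then have "?S = new_color_moves witness {..<5} h (uncolored_part witness h)"
      using False by (simp only: completing_strategy_def if_False)
    moreover have "uncolored_part witness h 0"
      using True False v by (auto simp: vertices_witness singletons_colored_def
          uncolored_part_witness partially_colored_part_witness)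
    ultimately show ?thesis
      using that by blast
  next
    case nsc: False
    then obtain i where i: "uncolored_singleton witness h i"
      by (auto simp: singletons_colored_def uncolored_singleton_witness)
    then have "\<exists>i. uncolored_singleton witness h i" ..
    then have "?S = new_color_moves witness {..<5} h (uncolored_singleton witness h)"
      using False by (simp only: completing_strategy_def if_False if_True)
    then show ?thesis
      using that i nsc unfolding uncolored_singleton_def by blast
  qed
  \<comment> \<open>One representative for each part other than \<open>i\<close>: at most four
    colors are in use, and one of the five is new.\<close>
  let ?D = "(\<lambda>i. (i, 0)) ` ({0, 1, 2, 3, 4} - {i}) :: vertex set"
  have i: "i \<in> {0, 1, 2, 3, 4}" "map_of h (i, 0) = None"
    using P(3) by (auto simp: uncolored_part_witness)
  have "ran (map_of h) \<subseteq> (\<lambda>v. the (map_of h v)) ` ?D"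
  proof (rule ran_map_of_subset_image[OF h])
    fix w
    assume w: "w \<in> vertices witness" "map_of h w \<noteq> None"
    have "map_of h (fst w, 0) = map_of h w"
      using w mono P(3,4) by (auto simp: vertices_witness uncolored_part_witness)
    moreover have "(fst w, 0) \<in> ?D"
      using w i calculation by (auto simp: vertices_witness)
    ultimately show "\<exists>u\<in>?D. map_of h u = map_of h w"
      by blast
  qed
  moreover have "card ?D < 5"
    using i(1) by (subst card_image) (auto simp: inj_on_def)
  ultimately obtain c where c: "c < 5" "c \<notin> ran (map_of h)"
    using new_color_exists[of ?D 5 h] by auto
  have "(i, 0) \<in> part witness i"
    using i(1) by (auto simp: part_witness)
  moreover have "(i, 0) \<in> vertices witness"
    using i(1) by (auto simp: vertices_witness)
  ultimately show ?thesis
    using P i c new_color_legal[of "(i, 0)" "vertices witness" h c "{..<5}" adjacent]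
    by (fastforce simp: new_color_moves_def)
qed

lemma completing_strategy_winning:
  "winning_strategy (vertices witness) adjacent {..<5} (completing_strategy {..<5})"
  unfolding winning_strategy_def
proof (intro ballI impI notI)
  fix h v
  assume "h \<in> plays (vertices witness) adjacent {..<5} (completing_strategy {..<5})"
    and "\<forall>m. m # h \<notin> plays (vertices witness) adjacent {..<5} (completing_strategy {..<5})"
    and "v \<in> vertices witness" and "map_of h v = None"
  then show False
    using completing_strategy_moves[of h v] plays.Alice plays.Bob by blast
qed

section \<open>The game chromatic number of the witness\<close>

lemma game_chromatic_number_witness: "game_chromatic_number (vertices witness) adjacent = 5"
  unfolding game_chromatic_number_def
proof (rule Least_equality)
  show "\<exists>S. winning_strategy (vertices witness) adjacent {..<5 :: nat} S"
    using completing_strategy_winning by blast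
next
  fix k :: nat
  \<comment> \<open>One vertex of each part gives a clique of size five.\<close>
  let ?K = "{(0, 0), (1, 0), (2, 0), (3, 0), (4, 0)} :: vertex set"
  assume "\<exists>S. winning_strategy (vertices witness) adjacent {..<k} S"
  then obtain S where "winning_strategy (vertices witness) adjacent {..<k} S" ..
  then have "card ?K \<le> k"
    by (rule winning_strategy_clique_le[OF _ _ symp_adjacent irreflp_adjacent])
      (auto simp: vertices_witness adjacent_def)
  then show "5 \<le> k"
    by simp
qed

section \<open>Failure of strategies that may color singletons first\<close>

lemma not_winning_if_stuck:
  assumes "h \<in> plays V adj C S" and "legal_moves V adj C h = {}"
    and "v \<in> V" and "map_of h v = None"
  shows "\<not> winning_strategy V adj C S"
  using assms legal_moves_if_Cons_in_plays[of _ h V adj C S]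
  by (auto simp: winning_strategy_def)

text \<open>An inclusion suffices as hypothesis: when choices are left free, a single lost play
  refutes the strategy. It applies to (A1), which offers further moves, as well as to (A1').\<close>

lemma not_winning_if_singletons_first:
  assumes S: "\<And>h :: (vertex, nat) play. \<exists>i. uncolored_singleton witness h i \<Longrightarrow>
    new_color_moves witness {..<5} h (uncolored_singleton witness h) \<subseteq> S h"
  shows "\<not> winning_strategy (vertices witness) adjacent {..<5 :: nat} S"
proof -
  let ?P = "plays (vertices witness) adjacent {..<5::nat} S"
  \<comment> \<open>Freshness is stated through \<open>set h\<close>, so that it simplifies on
    explicit plays.\<close>
  have single: "((i, 0), c) # h \<in> ?P"
    if "h \<in> ?P" "even (length h)" "i \<in> {1, 2, 3, 4}" "map_of h (i, 0) = None"
      "c < 5" "c \<notin> snd ` set h" for h i c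
  proof (rule plays.Alice)
    have u: "uncolored_singleton witness h i"
      using that by (simp add: uncolored_singleton_witness)
    have c: "c \<notin> ran (map_of h)"
      using that(6) by (force simp: ran_def dest: map_of_SomeD)
    have "(i, 0) \<in> part witness i"
      using that(3) by (auto simp: part_witness)
    then show "((i, 0), c) \<in> S h"
      using S[of h] u c that by (auto simp: new_color_moves_def)
    have "(i, 0) \<in> vertices witness"
      using that(3) by (auto simp: vertices_witness)
    then show "((i, 0), c) \<in> legal_moves (vertices witness) adjacent {..<5} h"
      using new_color_legal that c by fastforce
  qed (use that in auto)
  have "[((1, 0), 0)] \<in> ?P"
    by (rule single[OF plays.start]) auto
  then have "[((0, 0), 1), ((1, 0), 0)] \<in> ?P"
    by (rule plays.Bob) (auto simp: legal_moves_def vertices_witness)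
  then have "[((2, 0), 2), ((0, 0), 1), ((1, 0), 0)] \<in> ?P"
    by (rule single) auto
  then have "[((0, 1), 3), ((2, 0), 2), ((0, 0), 1), ((1, 0), 0)] \<in> ?P"
    by (rule plays.Bob) (auto simp: legal_moves_def vertices_witness)
  then have "[((3, 0), 4), ((0, 1), 3), ((2, 0), 2), ((0, 0), 1), ((1, 0), 0)] \<in> ?P"
    by (rule single) auto
  \<comment> \<open>Bob has spent colors 1 and 3 on the pair and Alice 0, 2 and 4 on three
    singletons, so \<open>(4, 0)\<close>, the only uncolored vertex, sees all five colors.\<close>
  then show ?thesis
    by (rule not_winning_if_stuck[where v = "(4, 0)"])
      (auto simp: legal_moves_def vertices_witness adjacent_def)
qed

theorem theorem2:
  shows "\<exists>rs :: nat list. part_sizes rs \<and>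
    (let V = vertices rs; C = {..<game_chromatic_number V adjacent} in
       \<not> winning_strategy V adjacent C (strategy_A1 rs C) \<and>
       \<not> winning_strategy V adjacent C (strategy_A1' rs C) \<and>
       (\<forall>j<length rs. rs ! j = 3 \<longrightarrow>
          \<not> winning_strategy V adjacent C (strategy_A2 rs C j) \<and>
          \<not> winning_strategy V adjacent C (strategy_A2' rs C j)) \<and>
       (odd (sum_list rs) \<longrightarrow>
          \<not> winning_strategy V adjacent C (strategy_A3 rs C) \<and>
          \<not> winning_strategy V adjacent C (strategy_A3' rs C)))"
proof (intro exI[of _ witness] conjI)
  show "part_sizes witness"
    by (simp add: part_sizes_def witness_def)
  have "\<not> winning_strategy (vertices witness) adjacent {..<5 :: nat} (strategy_A1 witness {..<5})"
    by (rule not_winning_if_singletons_first)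
      (auto simp: strategy_A1_def new_color_moves_def uncolored_singleton_def)
  moreover have
    "\<not> winning_strategy (vertices witness) adjacent {..<5 :: nat} (strategy_A1' witness {..<5})"
    by (rule not_winning_if_singletons_first) (auto simp: strategy_A1'_def)
  moreover have "\<forall>j<length witness. witness ! j \<noteq> 3"
    unfolding witness_index_cases by (auto simp: witness_def)
  moreover have "even (sum_list witness)"
    by (simp add: witness_def)
  ultimately show "let V = vertices witness; C = {..<game_chromatic_number V adjacent} in
       \<not> winning_strategy V adjacent C (strategy_A1 witness C) \<and>
       \<not> winning_strategy V adjacent C (strategy_A1' witness C) \<and>
       (\<forall>j<length witness. witness ! j = 3 \<longrightarrow>
          \<not> winning_strategy V adjacent C (strategy_A2 witness C j) \<and>
          \<not> winning_strategy V adjacent C (strategy_A2' witness C j)) \<and>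
       (odd (sum_list witness) \<longrightarrow>
          \<not> winning_strategy V adjacent C (strategy_A3 witness C) \<and>
          \<not> winning_strategy V adjacent C (strategy_A3' witness C))"
    unfolding Let_def game_chromatic_number_witness by blast
qed

end
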